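(* Let $A=(a_1\ \cdots\ a_n)$ be a $1\times n$ matrix of positive integers with $n\ge2$ and $a_1<a_2$, which admits a gluing of the first kind in the order $(a_1,\dots,a_n)$. Let $M=\{u_2,\dots,u_n\}$ be a minimal Markov basis for $A$ with $u_k=(u_{k,1},u_{k,2},\dots,u_{k,k-1},-u_{k,k},0,\dots,0)$ for each $k$, where all $u_{k,m}$ are non-negative integers and $u_{k,k}>0$. Then the following are equivalent: (1) $M$ is distance reducing; (2) $M$ reduces the distance of the circuits of $A$; (3) $M$ satisfies condition $R_{i,j}$ for every $2\le i<j\le n$.
   Context: For $z\in\mathbb Z^n$, $z^+,z^-\in\mathbb N^n$ denote the unique vectors with disjoint supports and $z=z^+-z^-$; $\|\cdot\|$ is the $1$-norm. A Markov basis is a set $B\subseteq\ker(A)$ whose binomials $x^{u^+}-x^{u^-}$ generate the toric ideal $I_A=\langle x^{u^+}-x^{u^-}:u\in\ker(A)\rangle$; minimal means no proper subset is a Markov basis. For nonzero $z\in\ker(A)$, $u\in\ker(A)$ reduces the distance of $z$ if there exist $(p,q)\in\{(z^+,z^-),(z^-,z^+)\}$ and $\varepsilon\in\{\pm1\}$ with $p+\varepsilon u\in\mathbb N^n$ and $\|p+\varepsilon u-q\|<\|z\|$; $B$ reduces the distance of $Z$ if each nonzero $z\in Z$ has its distance reduced by some element of $B$; $B$ is distance reducing if it reduces the distance of $\ker(A)$. A circuit is a nonzero element of $\ker(A)$ with support of size exactly two. $A$ admits a gluing of the first kind in the order $(a_1,\dots,a_n)$ if for each $k\in\{1,\dots,n-1\}$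 there is $x\in\mathbb N\{a_1,\dots,a_k\}\cap a_{k+1}\mathbb N$ with $x\mathbb Z=\mathbb Z\{a_1,\dots,a_k\}\cap a_{k+1}\mathbb Z$ (here $\mathbb N X$, $\mathbb ZX$ are the semigroup and group generated by $X$). For $2\le i<j\le n$, $M$ satisfies $R_{i,j}$ if at least one of: (i) $u_{i,1}+\dots+u_{i,i-1}<u_{i,i}$; (ii) there is $\ell\in\{i+1,\dots,j-1\}$ with $u_{\ell,m}=0$ for all $m\in\{1,\dots,\ell-1\}\setminus\{i\}$ and $u_{\ell,i}>u_{\ell,\ell}$; (iii) $\sum_{k=1}^{j}u_{j,k}<2(u_{j,i}+u_{j,j})$. *)

theory Defs
  imports Main "HOL-Library.Poly_Mapping"
begin

text \<open>Integer vectors in Z^n are functions nat => int, indexed by 1..n (entries outside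
  1..n are required to be 0 where relevant). The matrix A = (a_1 ... a_n) is a function a.\<close>

definition posp :: "(nat \<Rightarrow> int) \<Rightarrow> nat \<Rightarrow> int" where
  "posp z i = max (z i) 0"

definition negp :: "(nat \<Rightarrow> int) \<Rightarrow> nat \<Rightarrow> int" where
  "negp z i = max (- z i) 0"

definition norm1 :: "nat \<Rightarrow> (nat \<Rightarrow> int) \<Rightarrow> int" where
  "norm1 n z = (\<Sum>i=1..n. \<bar>z i\<bar>)"

definition kerA :: "nat \<Rightarrow> (nat \<Rightarrow> int) \<Rightarrow> (nat \<Rightarrow> int) set" where
  "kerA n a = {z. (\<forall>i. i \<notin> {1..n} \<longrightarrow> z i = 0) \<and> (\<Sum>i=1..n. a i * z i) = 0}"

text \<open>Polynomial ring k[x_1,...,x_n] (inside the polynomial ring in countably many variables).\<close>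

type_synonym 'k mpoly = "(nat \<Rightarrow>\<^sub>0 nat) \<Rightarrow>\<^sub>0 'k"

definition Var :: "nat \<Rightarrow> 'k::comm_ring_1 mpoly" where
  "Var i = Poly_Mapping.single (Poly_Mapping.single i 1) 1"

definition monom_vec :: "nat \<Rightarrow> (nat \<Rightarrow> int) \<Rightarrow> 'k::comm_ring_1 mpoly" where
  "monom_vec n e = (\<Prod>i=1..n. Var i ^ nat (e i))"

definition binom :: "nat \<Rightarrow> (nat \<Rightarrow> int) \<Rightarrow> 'k::comm_ring_1 mpoly" where
  "binom n u = monom_vec n (posp u) - monom_vec n (negp u)"

definition ideal_gen :: "'r::comm_ring_1 set \<Rightarrow> 'r set" where
  "ideal_gen G = {\<Sum>g\<in>F. c g * g | F c. finite F \<and> F \<subseteq> G}"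

definition toric_ideal :: "nat \<Rightarrow> (nat \<Rightarrow> int) \<Rightarrow> 'k::field mpoly set" where
  "toric_ideal n a = ideal_gen (binom n ` kerA n a)"

definition markov_basis :: "'k::field itself \<Rightarrow> nat \<Rightarrow> (nat \<Rightarrow> int) \<Rightarrow> (nat \<Rightarrow> int) set \<Rightarrow> bool" where
  "markov_basis TYPE('k) n a B \<longleftrightarrow>
     B \<subseteq> kerA n a \<and> ideal_gen (binom n ` B) = (toric_ideal n a :: 'k mpoly set)"

definition minimal_markov_basis :: "'k::field itself \<Rightarrow> nat \<Rightarrow> (nat \<Rightarrow> int) \<Rightarrow> (nat \<Rightarrow> int) set \<Rightarrow> bool" where
  "minimal_markov_basis K n a B \<longleftrightarrow>
     markov_basis K n a B \<and> (\<forall>B'. B' \<subset> B \<longrightarrow> \<not> markov_basis K n a B')"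

definition reduces_distance_of_vec :: "nat \<Rightarrow> (nat \<Rightarrow> int) \<Rightarrow> (nat \<Rightarrow> int) \<Rightarrow> bool" where
  "reduces_distance_of_vec n u z \<longleftrightarrow>
     (\<exists>(p, q) \<in> {(posp z, negp z), (negp z, posp z)}. \<exists>\<epsilon>\<in>{1, -1::int}.
        (\<forall>i\<in>{1..n}. p i + \<epsilon> * u i \<ge> 0) \<and>
        norm1 n (\<lambda>i. p i + \<epsilon> * u i - q i) < norm1 n z)"

definition reduces_distance :: "nat \<Rightarrow> (nat \<Rightarrow> int) \<Rightarrow> (nat \<Rightarrow> int) set \<Rightarrow> (nat \<Rightarrow> int) set \<Rightarrow> bool" where
  "reduces_distance n a B Z \<longleftrightarrow>
     (\<forall>z\<in>Z. z \<noteq> (\<lambda>_. 0) \<longrightarrow> (\<exists>u\<in>B. reduces_distance_of_vec n u z))"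

definition distance_reducing :: "nat \<Rightarrow> (nat \<Rightarrow> int) \<Rightarrow> (nat \<Rightarrow> int) set \<Rightarrow> bool" where
  "distance_reducing n a B \<longleftrightarrow> reduces_distance n a B (kerA n a)"

definition circuits :: "nat \<Rightarrow> (nat \<Rightarrow> int) \<Rightarrow> (nat \<Rightarrow> int) set" where
  "circuits n a = {z \<in> kerA n a. z \<noteq> (\<lambda>_. 0) \<and> card {i\<in>{1..n}. z i \<noteq> 0} = 2}"

definition semigroup_gen :: "(nat \<Rightarrow> int) \<Rightarrow> nat \<Rightarrow> int set" where
  "semigroup_gen a k = {\<Sum>i=1..k. int (l i) * a i | l. True}"

definition group_gen :: "(nat \<Rightarrow> int) \<Rightarrow> nat \<Rightarrow> int set" where
  "group_gen a k = {\<Sum>i=1..k. l i * a i | l. True}"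

definition gluing_first_kind :: "nat \<Rightarrow> (nat \<Rightarrow> int) \<Rightarrow> bool" where
  "gluing_first_kind n a \<longleftrightarrow>
     (\<forall>k\<in>{1..n-1}. \<exists>x. x \<in> semigroup_gen a k \<and> x \<in> {a (k+1) * int m | m. True} \<and>
        {x * t | t. True} = group_gen a k \<inter> {a (k+1) * t | t. True})"

definition uvec :: "(nat \<Rightarrow> nat \<Rightarrow> nat) \<Rightarrow> nat \<Rightarrow> nat \<Rightarrow> int" where
  "uvec c k m = (if 1 \<le> m \<and> m < k then int (c k m) else if m = k then - int (c k k) else 0)"

definition cond_R :: "(nat \<Rightarrow> nat \<Rightarrow> nat) \<Rightarrow> nat \<Rightarrow> nat \<Rightarrow> bool" where
  "cond_R c i j \<longleftrightarrow>
     (\<Sum>m=1..i-1. c i m) < c i i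
     \<or> (\<exists>l\<in>{i+1..j-1}. (\<forall>m\<in>{1..l-1} - {i}. c l m = 0) \<and> c l i > c l l)
     \<or> (\<Sum>k=1..j. c j k) < 2 * (c j i + c j j)"

end

theory Submission
  imports Defs
begin

text \<open>
  Adding \<open>u\<^sub>k\<close> only consumes the variable \<open>k\<close> and subtracting it only consumes smaller variables, so
  whether \<open>\<plusminus>u\<^sub>k\<close> reduces \<open>z\<close> is an explicit inequality between entries of \<open>u\<^sub>k\<close> and \<open>z\<close>.

  (3) to (1): the vectors \<open>u\<^sub>k\<close> generate the kernel lattice, so \<open>z = \<Sum> \<lambda>\<^sub>k u\<^sub>k\<close>; let \<open>j\<close> be the
  largest index with \<open>\<lambda>\<^sub>j \<noteq> 0\<close>, and let \<open>\<lambda>\<^sub>j < 0\<close>. If \<open>z\<close> is not reduced, each alternative of \<open>R\<^sub>m\<^sub>j\<close>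
  bounds the entry \<open>m\<close> of the negative part of \<open>z\<close>, which forces the sign of \<open>\<lambda>\<^sub>m\<close> once the signs
  of all later coefficients are known. The descent ends with \<open>\<lambda>\<^sub>2 < 0\<close>, and \<open>a\<^sub>1 < a\<^sub>2\<close> makes
  \<open>-u\<^sub>2\<close> a reduction of \<open>z\<close>.

  (2) to (3): call \<open>l\<close> a good child of \<open>s\<close> if \<open>u\<^sub>l\<close> has support \<open>{s, l}\<close> and trading \<open>s\<close> for \<open>l\<close>
  lowers the degree. The circuit on \<open>{i, j}\<close> may be reduced by a good child \<open>l > j\<close> of \<open>i\<close> or \<open>j\<close>
  although \<open>R\<^sub>i\<^sub>j\<close> fails; replacing \<open>i\<close> or \<open>j\<close> by \<open>l\<close> gives a circuit on larger indices for which
  the same dichotomy holds, and this cannot go on forever.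
\<close>

section \<open>Markov bases generate the kernel lattice\<close>

definition coset_sum :: "(nat \<Rightarrow>\<^sub>0 nat) set \<Rightarrow> 'k::comm_ring_1 mpoly \<Rightarrow> 'k" where
  "coset_sum C f = (\<Sum>m\<in>Poly_Mapping.keys f. if m \<in> C then Poly_Mapping.lookup f m else 0)"

lemma coset_sum_zero [simp]: "coset_sum C 0 = 0"
  by (simp add: coset_sum_def)

lemma coset_sum_single [simp]:
  "coset_sum C (Poly_Mapping.single m x) = (if m \<in> C then x else 0)"
  by (simp add: coset_sum_def)

lemma coset_sum_add: "coset_sum C (f + g) = coset_sum C f + coset_sum C g"
  unfolding coset_sum_def
  by (rule setsum_keys_plus_distrib) auto

lemma coset_sum_diff: "coset_sum C (f - g) = coset_sum C f - coset_sum C g"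
  using coset_sum_add[of C "f - g" g] by simp

lemma coset_sum_sum: "coset_sum C (\<Sum>x\<in>F. h x) = (\<Sum>x\<in>F. coset_sum C (h x))"
  by (induction F rule: infinite_finite_induct) (simp_all add: coset_sum_add)

text \<open>Each monomial multiple of the binomial has both of its terms in \<open>C\<close> or both
  outside, so their coefficients 1 and -1 cancel. Additivity extends this to all
  \<open>f\<close>.\<close>

lemma coset_sum_mult_binomial:
  assumes "\<And>m. m + x \<in> C \<longleftrightarrow> m + y \<in> C"
  shows "coset_sum C (f * (Poly_Mapping.single x 1 - Poly_Mapping.single y 1)) = 0"
proof (induction f rule: Poly_Mapping.update_induct)
  case (update f k v)
  have "Poly_Mapping.update k v f = f + Poly_Mapping.single k v"
    using update(1)
    by (intro poly_mapping_eqI) (auto simp: lookup_update lookup_add lookup_single when_def in_keys_iff)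
  then show ?case
    using update(3) assms[of k]
    by (simp add: distrib_right right_diff_distrib mult_single coset_sum_add coset_sum_diff)
qed simp

definition expo :: "nat \<Rightarrow> (nat \<Rightarrow> int) \<Rightarrow> (nat \<Rightarrow>\<^sub>0 nat)" where
  "expo n e = (\<Sum>i=1..n. Poly_Mapping.single i (nat (e i)))"

lemma lookup_expo: "Poly_Mapping.lookup (expo n e) i = (if i \<in> {1..n} then nat (e i) else 0)"
  by (simp add: expo_def lookup_sum lookup_single when_def)

lemma Var_power: "Var i ^ k = Poly_Mapping.single (Poly_Mapping.single i k) 1"
  by (induction k) (simp_all add: Var_def mult_single single_add[symmetric] flip: single_one)

lemma prod_single_one:
  "(\<Prod>i\<in>I. Poly_Mapping.single (h i) (1::'k::comm_ring_1)) = Poly_Mapping.single (\<Sum>i\<in>I. h i) 1"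
  by (induction I rule: infinite_finite_induct) (simp_all add: mult_single)

lemma monom_vec_eq_single: "monom_vec n e = Poly_Mapping.single (expo n e) 1"
  by (simp add: monom_vec_def expo_def Var_power prod_single_one)

lemma kerA_outside: "z \<in> kerA n a \<Longrightarrow> i \<notin> {1..n} \<Longrightarrow> z i = 0"
  by (simp add: kerA_def)

lemma posp_minus_negp: "posp z i - negp z i = z i"
  by (simp add: posp_def negp_def)

text \<open>Summing the coefficients over the monomials in one coset of \<open>L\<close> annihilates the ideal
  generated by the binomials of \<open>L\<close>, so a pure binomial in that ideal lies in one coset.\<close>

lemma markov_basis_generates_lattice:
  assumes markov: "markov_basis TYPE('k::field) n a B"
    and BL: "B \<subseteq> L" and L0: "(\<lambda>_. 0) \<in> L"
    and Ladd: "\<And>x y. x \<in> L \<Longrightarrow> y \<in> L \<Longrightarrow> (\<lambda>i. x i + y i) \<in> L"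
    and Lneg: "\<And>x. x \<in> L \<Longrightarrow> (\<lambda>i. - x i) \<in> L"
    and z: "z \<in> kerA n a"
  shows "z \<in> L"
proof -
  \<comment> \<open>Exponents congruent to z^+ modulo \<open>L\<close>. Both monomials of a binomial
    from \<open>B\<close> differ by an element of \<open>L\<close>, as \<open>shift\<close>
    needs.\<close>
  define C where "C = {m. (\<lambda>i. int (Poly_Mapping.lookup m i) - posp z i) \<in> L}"
  have pos: "int (Poly_Mapping.lookup (expo n (posp y)) i) = posp y i"
    and neg: "int (Poly_Mapping.lookup (expo n (negp y)) i) = negp y i"
    if "y \<in> kerA n a" for y i
    using kerA_outside[OF that, of i] by (auto simp: lookup_expo posp_def negp_def)
  have shift: "m + expo n (posp u) \<in> C \<longleftrightarrow> m + expo n (negp u) \<in> C" if "u \<in> B" for u m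
  proof -
    have u: "u \<in> kerA n a" "u \<in> L"
      using that markov BL by (auto simp: markov_basis_def)
    let ?p = "\<lambda>i. int (Poly_Mapping.lookup (m + expo n (posp u)) i) - posp z i"
    let ?q = "\<lambda>i. int (Poly_Mapping.lookup (m + expo n (negp u)) i) - posp z i"
    have pq: "?p = (\<lambda>i. ?q i + u i)" "?q = (\<lambda>i. ?p i + - u i)"
      by (simp_all add: lookup_add pos[OF u(1)] neg[OF u(1)] fun_eq_iff)
        (auto simp: posp_def negp_def)
    have "?q \<in> L \<Longrightarrow> ?p \<in> L"
      by (subst pq(1)) (rule Ladd, simp_all add: u)
    moreover have "?p \<in> L \<Longrightarrow> ?q \<in> L"
      by (subst pq(2)) (rule Ladd, simp_all add: u Lneg)
    ultimately show ?thesis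
      unfolding C_def by blast
  qed
  have "binom n z \<in> (ideal_gen (binom n ` kerA n a) :: 'k mpoly set)"
    unfolding ideal_gen_def
    using z by (intro CollectI exI[of _ "{binom n z}"] exI[of _ "\<lambda>_. 1"]) auto
  then have "binom n z \<in> (ideal_gen (binom n ` B) :: 'k mpoly set)"
    using markov by (simp add: markov_basis_def toric_ideal_def)
  then obtain F h where F: "F \<subseteq> binom n ` B" and eq: "(binom n z :: 'k mpoly) = (\<Sum>g\<in>F. h g * g)"
    unfolding ideal_gen_def by blast
  have "coset_sum C (h g * g) = 0" if g: "g \<in> F" for g
  proof -
    obtain u where "u \<in> B" "g = binom n u"
      using g F by blast
    then show ?thesis
      using coset_sum_mult_binomial[OF shift] by (simp add: binom_def monom_vec_eq_single)
  qed
  then have "coset_sum C (binom n z :: 'k mpoly) = 0"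
    by (simp add: eq coset_sum_sum)
  moreover have "expo n (posp z) \<in> C"
    using L0 by (simp add: C_def pos[OF z])
  \<comment> \<open>The term at z^+ contributes 1 to a vanishing sum, so the term at z^- must lie in
    \<open>C\<close> to cancel it.\<close>
  ultimately have "expo n (negp z) \<in> C"
    by (simp add: binom_def monom_vec_eq_single coset_sum_diff split: if_splits)
  then have "(\<lambda>i. negp z i - posp z i) \<in> L"
    by (simp add: C_def neg[OF z])
  from Lneg[OF this] show ?thesis
    by (simp add: posp_minus_negp)
qed

section \<open>Distance reduction by triangular vectors\<close>

definition offdiag :: "(nat \<Rightarrow> nat \<Rightarrow> nat) \<Rightarrow> nat \<Rightarrow> nat" where
  "offdiag c k = (\<Sum>m=1..k-1. c k m)"

text \<open>Adding \<open>uvec c k\<close> to z^+ moves mass from index k down to smaller indices;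
  \<open>up_reduces\<close> describes subtraction, which moves it up to k. The factor 2 arises
  because a unit landing on z^- lowers the distance by one instead of raising it by one.\<close>

definition down_reduces :: "(nat \<Rightarrow> nat \<Rightarrow> nat) \<Rightarrow> nat \<Rightarrow> (nat \<Rightarrow> int) \<Rightarrow> bool" where
  "down_reduces c k z \<longleftrightarrow> int (c k k) \<le> posp z k \<and>
     int (offdiag c k) < int (c k k) + 2 * (\<Sum>m=1..k-1. min (int (c k m)) (negp z m))"

definition up_reduces :: "(nat \<Rightarrow> nat \<Rightarrow> nat) \<Rightarrow> nat \<Rightarrow> (nat \<Rightarrow> int) \<Rightarrow> bool" where
  "up_reduces c k z \<longleftrightarrow> (\<forall>m\<in>{1..k-1}. int (c k m) \<le> posp z m) \<and>
     int (c k k) < int (offdiag c k) + 2 * min (int (c k k)) (negp z k)"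

lemma posp_nonneg: "posp z i \<ge> 0" and negp_nonneg: "negp z i \<ge> 0"
  by (simp_all add: posp_def negp_def)

lemma posp_uminus: "posp (\<lambda>i. - z i) = negp z" and negp_uminus: "negp (\<lambda>i. - z i) = posp z"
  by (simp_all add: posp_def negp_def fun_eq_iff)

lemma sum_split_at:
  fixes f :: "nat \<Rightarrow> int"
  assumes "k \<in> {1..n}" "\<And>i. i \<in> {k+1..n} \<Longrightarrow> f i = 0"
  shows "(\<Sum>i=1..n. f i) = (\<Sum>i=1..k-1. f i) + f k"
proof -
  have "(\<Sum>i=1..n. f i) = (\<Sum>i=1..k. f i)"
    using assms by (intro sum.mono_neutral_right) auto
  also have "\<dots> = (\<Sum>i=1..k-1. f i) + f k"
    using assms(1) sum.cl_ivl_Suc[of f 1 "k - 1"] by simp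
  finally show ?thesis .
qed

text \<open>Coordinatewise: a feasible removal takes place where z^- vanishes and lowers the
  distance fully, while an addition first cancels z^- and raises the distance only by the
  excess.\<close>

lemma norm1_after_move:
  assumes "\<forall>i\<in>{1..n}. posp z i + v i \<ge> 0"
  shows "norm1 n (\<lambda>i. posp z i + v i - negp z i) = norm1 n z
      - (\<Sum>i=1..n. negp v i - posp v i + 2 * min (posp v i) (negp z i))"
  unfolding norm1_def sum_subtractf[symmetric]
proof (rule sum.cong[OF refl])
  fix i assume "i \<in> {1..n}"
  then have "posp z i + v i \<ge> 0" using assms by blast
  then show "\<bar>posp z i + v i - negp z i\<bar> = \<bar>z i\<bar>
      - (negp v i - posp v i + 2 * min (posp v i) (negp z i))"
    by (auto simp: posp_def negp_def min_def max_def split: if_splits)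
qed

lemma add_uvec_reduces_iff:
  assumes k: "k \<in> {1..n}"
  shows "(\<forall>i\<in>{1..n}. posp z i + uvec c k i \<ge> 0) \<and>
      norm1 n (\<lambda>i. posp z i + uvec c k i - negp z i) < norm1 n z \<longleftrightarrow> down_reduces c k z"
proof -
  have feas: "(\<forall>i\<in>{1..n}. posp z i + uvec c k i \<ge> 0) \<longleftrightarrow> int (c k k) \<le> posp z k"
    using k by (auto simp: uvec_def posp_def)
  have "norm1 n (\<lambda>i. posp z i + uvec c k i - negp z i) < norm1 n z \<longleftrightarrow>
      int (offdiag c k) < int (c k k) + 2 * (\<Sum>m=1..k-1. min (int (c k m)) (negp z m))"
    if f: "\<forall>i\<in>{1..n}. posp z i + uvec c k i \<ge> 0"
  proof -
    let ?g = "\<lambda>i. negp (uvec c k) i - posp (uvec c k) i + 2 * min (posp (uvec c k) i) (negp z i)"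
    have "norm1 n (\<lambda>i. posp z i + uvec c k i - negp z i) = norm1 n z - (\<Sum>i=1..n. ?g i)"
      by (rule norm1_after_move[OF f])
    moreover have "(\<Sum>i=1..n. ?g i) = (\<Sum>i=1..k-1. ?g i) + ?g k"
      by (rule sum_split_at[OF k]) (auto simp: uvec_def posp_def negp_def)
    moreover have "?g k = int (c k k)"
      by (simp add: uvec_def posp_def negp_def)
    moreover have "(\<Sum>i=1..k-1. ?g i) = (\<Sum>i=1..k-1. 2 * min (int (c k i)) (negp z i) - int (c k i))"
      by (rule sum.cong) (auto simp: uvec_def posp_def negp_def)
    ultimately show ?thesis
      by (simp add: sum_subtractf sum_distrib_left offdiag_def) linarith
  qed
  with feas show ?thesis
    unfolding down_reduces_def by blast
qed

lemma subtract_uvec_reduces_iff: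
  assumes k: "k \<in> {1..n}"
  shows "(\<forall>i\<in>{1..n}. posp z i - uvec c k i \<ge> 0) \<and>
      norm1 n (\<lambda>i. posp z i - uvec c k i - negp z i) < norm1 n z \<longleftrightarrow> up_reduces c k z"
proof -
  let ?v = "\<lambda>i. - uvec c k i"
  have feas: "(\<forall>i\<in>{1..n}. posp z i + ?v i \<ge> 0) \<longleftrightarrow> (\<forall>m\<in>{1..k-1}. int (c k m) \<le> posp z m)"
    using k by (auto simp: uvec_def posp_def)
  have "norm1 n (\<lambda>i. posp z i + ?v i - negp z i) < norm1 n z \<longleftrightarrow>
      int (c k k) < int (offdiag c k) + 2 * min (int (c k k)) (negp z k)"
    if f: "\<forall>i\<in>{1..n}. posp z i + ?v i \<ge> 0"
  proof -
    let ?g = "\<lambda>i. negp ?v i - posp ?v i + 2 * min (posp ?v i) (negp z i)"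
    have "norm1 n (\<lambda>i. posp z i + ?v i - negp z i) = norm1 n z - (\<Sum>i=1..n. ?g i)"
      by (rule norm1_after_move[OF f])
    moreover have "(\<Sum>i=1..n. ?g i) = (\<Sum>i=1..k-1. ?g i) + ?g k"
      by (rule sum_split_at[OF k]) (auto simp: uvec_def posp_def negp_def)
    moreover have "?g k = 2 * min (int (c k k)) (negp z k) - int (c k k)"
      by (simp add: uvec_def posp_def negp_def)
    moreover have "(\<Sum>i=1..k-1. ?g i) = (\<Sum>i=1..k-1. int (c k i))"
      by (rule sum.cong) (auto simp: uvec_def posp_def negp_def)
    ultimately show ?thesis
      by (simp add: offdiag_def) linarith
  qed
  with feas show ?thesis
    unfolding up_reduces_def diff_conv_add_uminus by blast
qed

lemma norm1_uminus: "norm1 n (\<lambda>i. - z i) = norm1 n z"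
  by (simp add: norm1_def)

text \<open>The four cases are the two signs of the move and the two orders of (p, q); exchanging p
  and q amounts to negating z.\<close>

lemma reduces_uvec_iff:
  assumes k: "k \<in> {1..n}"
  shows "reduces_distance_of_vec n (uvec c k) z \<longleftrightarrow>
     down_reduces c k z \<or> up_reduces c k z \<or>
     down_reduces c k (\<lambda>i. - z i) \<or> up_reduces c k (\<lambda>i. - z i)"
  unfolding add_uvec_reduces_iff[OF k, symmetric] subtract_uvec_reduces_iff[OF k, symmetric]
    posp_uminus negp_uminus norm1_uminus
  by (auto simp: reduces_distance_of_vec_def)

lemma reduces_uvec_uminus:
  assumes "k \<in> {1..n}"
  shows "reduces_distance_of_vec n (uvec c k) (\<lambda>i. - z i) \<longleftrightarrow> reduces_distance_of_vec n (uvec c k) z"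
  using assms by (auto simp: reduces_uvec_iff)


lemma offdiag_single:
  assumes "s \<in> {1..k-1}" "\<forall>m\<in>{1..k-1} - {s}. c k m = 0"
  shows "offdiag c k = c k s"
  unfolding offdiag_def using assms by (subst sum.remove[of _ s]) auto

lemma sum_upto_diag:
  assumes "j \<ge> 1"
  shows "(\<Sum>k=1..j. c j k) = offdiag c j + c j j"
  using assms sum.cl_ivl_Suc[of "c j" 1 "j - 1"] by (simp add: offdiag_def)

section \<open>The conditions imply distance reduction\<close>

locale triangular_kernel_vectors =
  fixes n :: nat and a :: "nat \<Rightarrow> int" and c :: "nat \<Rightarrow> nat \<Rightarrow> nat"
  assumes a_pos: "i \<in> {1..n} \<Longrightarrow> a i > 0"
    and diag_pos: "k \<in> {2..n} \<Longrightarrow> c k k > 0"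
    and uvec_kerA: "k \<in> {2..n} \<Longrightarrow> uvec c k \<in> kerA n a"
begin

lemma relation:
  assumes "k \<in> {2..n}"
  shows "(\<Sum>m=1..k-1. a m * int (c k m)) = a k * int (c k k)"
proof -
  have "0 = (\<Sum>i=1..n. a i * uvec c k i)"
    using uvec_kerA[OF assms] by (simp add: kerA_def)
  also have "\<dots> = (\<Sum>i=1..k-1. a i * uvec c k i) + a k * uvec c k k"
    using assms by (intro sum_split_at) (auto simp: uvec_def)
  also have "(\<Sum>i=1..k-1. a i * uvec c k i) = (\<Sum>i=1..k-1. a i * int (c k i))"
    by (rule sum.cong) (auto simp: uvec_def)
  finally show ?thesis
    by (simp add: uvec_def)
qed

lemma offdiag_nonzero:
  assumes "k \<in> {2..n}"
  obtains m where "m \<in> {1..k-1}" "c k m > 0"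
proof (cases "\<forall>m\<in>{1..k-1}. c k m = 0")
  case True
  then have "a k * int (c k k) = 0"
    using relation[OF assms] by simp
  then show ?thesis
    using diag_pos[OF assms] a_pos[of k] assms by auto
qed (use that in auto)

text \<open>By triangularity only vectors with index at least m reach entry m. Index 1 has no vector
  of its own, hence the conditional.\<close>

lemma uvec_combination_entry:
  assumes "m \<in> {1..n}"
  shows "(\<Sum>k=2..n. lam k * uvec c k m) =
    (\<Sum>k=m+1..n. lam k * int (c k m)) - (if m \<ge> 2 then lam m * int (c m m) else 0)"
proof -
  have "(\<Sum>k=2..n. lam k * uvec c k m) = (\<Sum>k\<in>(if m \<ge> 2 then {m} else {}) \<union> {m+1..n}. lam k * uvec c k m)"
    using assms by (intro sum.mono_neutral_right) (auto simp: uvec_def)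
  also have "\<dots> = (\<Sum>k\<in>(if m \<ge> 2 then {m} else {}). lam k * uvec c k m) + (\<Sum>k=m+1..n. lam k * uvec c k m)"
    by (intro sum.union_disjoint) auto
  also have "(\<Sum>k=m+1..n. lam k * uvec c k m) = (\<Sum>k=m+1..n. lam k * int (c k m))"
    using assms by (intro sum.cong) (auto simp: uvec_def)
  finally show ?thesis
    by (simp add: uvec_def)
qed

text \<open>The failure of every move on z bounds entries of z^-, and the entry equation turns these
  bounds into signs of the coefficients, by downward induction from j to 2.\<close>

lemma reduced_if_cond_R:
  assumes j: "j \<in> {2..n}" and c12: "c 2 2 < c 2 1"
    and R: "\<And>i. 2 \<le> i \<Longrightarrow> i < j \<Longrightarrow> cond_R c i j"
    and lam_j: "lam j < 0" and lam_0: "\<And>k. k \<in> {j+1..n} \<Longrightarrow> lam k = 0"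
    and z: "z = (\<lambda>i. \<Sum>k=2..n. lam k * uvec c k i)"
  shows "\<exists>k\<in>{2..n}. reduces_distance_of_vec n (uvec c k) z"
proof (rule ccontr)
  assume "\<not> ?thesis"
  then have down: "\<not> down_reduces c k z" and down': "\<not> down_reduces c k (\<lambda>i. - z i)"
    and up': "\<not> up_reduces c k (\<lambda>i. - z i)" if "k \<in> {2..n}" for k
    using that by (auto simp: reduces_uvec_iff)
  have min_nonneg: "(\<Sum>m=1..k-1. min (int (c k m)) (f m)) \<ge> 0" if "\<And>m. f m \<ge> 0" for k and f :: "nat \<Rightarrow> int"
    by (rule sum_nonneg) (simp add: that)
  have tail: "(\<Sum>k=m+1..n. lam k * int (c k m)) \<le> lam l * int (c l m)"
    if "\<And>k. k \<in> {m+1..j} \<Longrightarrow> lam k \<le> 0" "l \<in> {m+1..j}" for m l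
  proof -
    have "lam k * int (c k m) \<le> 0" if "k \<in> {m+1..n}" for k
      using \<open>\<And>k. k \<in> {m+1..j} \<Longrightarrow> lam k \<le> 0\<close>[of k] lam_0[of k] that
      by (cases "k \<le> j") (auto intro: mult_nonpos_nonneg)
    then have "(\<Sum>k\<in>{m+1..n}-{l}. lam k * int (c k m)) \<le> 0"
      by (intro sum_nonpos) auto
    then show ?thesis
      using that j by (subst sum.remove[of _ l]) auto
  qed
  have claim: "lam m \<le> 0 \<and> (\<not> offdiag c m < c m m \<longrightarrow> lam m < 0)" if "m \<in> {2..j}" for m
    using that
  proof (induction "j - m" arbitrary: m rule: less_induct)
    case less
    have IH: "lam k \<le> 0 \<and> (\<not> offdiag c k < c k k \<longrightarrow> lam k < 0)" if "k \<in> {m+1..j}" for k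
      using less.prems that by (intro less.hyps) auto
    show ?case
    proof (cases "m = j")
      case False
      then have m: "m \<in> {2..n}" "m < j" "m \<ge> 2"
        using less.prems j by auto
      have zm: "z m = (\<Sum>k=m+1..n. lam k * int (c k m)) - lam m * int (c m m)"
        using uvec_combination_entry[of m lam] m by (simp add: z)
      \<comment> \<open>Solve the equation for \<open>z m\<close>, and keep a single term of the
        nonpositive tail.\<close>
      have key: "lam m * int (c m m) \<le> negp z m + lam l * int (c l m)" if "l \<in> {m+1..j}" for l
        using tail[OF _ that] IH zm by (fastforce simp: negp_def)
      have pos: "c m m > 0"
        using diag_pos m by blast
      have negI: "lam m < 0" if "lam m * int (c m m) < 0"
        using that pos by (simp add: mult_less_0_iff)
      have drop: "lam l * int (c l m) \<le> - int (c l m)" if "lam l < 0" for l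
        using mult_right_mono[of "lam l" "-1" "int (c l m)"] that by simp
      consider (1) "offdiag c m < c m m"
        | (2) l where "\<not> offdiag c m < c m m" "l \<in> {m+1..j-1}" "\<forall>i\<in>{1..l-1} - {m}. c l i = 0" "c l m > c l l"
        | (3) "(\<Sum>k=1..j. c j k) < 2 * (c j m + c j j)"
        using R[of m] m unfolding cond_R_def offdiag_def by blast
      then show ?thesis
      proof cases
        case 1
        \<comment> \<open>Otherwise adding \<open>uvec c m\<close> to z^- would be feasible and
          would lower the degree, hence reduce even without any cancellation.\<close>
        have "negp z m < int (c m m)"
          using down'[OF m(1)] 1 min_nonneg[of "posp z" m] posp_nonneg[of z]
          by (auto simp: down_reduces_def posp_uminus negp_uminus)
        moreover have "lam j * int (c j m) \<le> 0"
          using lam_j by (intro mult_nonpos_nonneg) auto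
        ultimately have "lam m * int (c m m) < 1 * int (c m m)"
          using key[of j] m by simp
        then have "lam m < 1"
          using pos by (simp only: mult_less_cancel_right)
        then show ?thesis
          using 1 by simp
      next
        case 2
        have l: "l \<in> {2..n}" "m \<in> {1..l-1}"
          using 2(2) m j by auto
        have off: "offdiag c l = c l m"
          using l(2) 2(3) by (rule offdiag_single)
        have "lam l < 0"
          using IH[of l] 2 off by auto
        \<comment> \<open>Index m is all that subtracting \<open>uvec c l\<close> consumes, so a
          larger entry of z^- would allow this degree-lowering move.\<close>
        moreover have "negp z m < int (c l m)"
        proof (rule ccontr)
          assume "\<not> ?thesis"
          then have "\<forall>i\<in>{1..l-1}. int (c l i) \<le> negp z i"
            using 2(3) negp_nonneg[of z] by (metis Diff_iff linorder_not_less of_nat_0 singletonD)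
          then show False
            using up'[OF l(1)] 2(4) off posp_nonneg[of z l]
            by (simp add: up_reduces_def posp_uminus negp_uminus)
        qed
        ultimately show ?thesis
          using key[of l] drop[of l] 2(2) negI by fastforce
      next
        case 3
        have zj: "z j = - lam j * int (c j j)"
          using uvec_combination_entry[of j lam] j lam_0 by (simp add: z)
        \<comment> \<open>Adding \<open>uvec c j\<close> to z^+ is therefore feasible. It fails to
          reduce, so by (iii) its overlap with z^- cannot contain all of
          \<open>c j m\<close>.\<close>
        have "int (c j j) \<le> z j"
          using mult_right_mono[of 1 "- lam j" "int (c j j)"] lam_j zj by simp
        then have fails: "int (c j j) + 2 * (\<Sum>m=1..j-1. min (int (c j m)) (negp z m)) \<le> int (offdiag c j)"
          using down[OF j] by (simp add: down_reduces_def posp_def)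
        have "min (int (c j m)) (negp z m) \<le> (\<Sum>m=1..j-1. min (int (c j m)) (negp z m))"
          using m negp_nonneg[of z] by (intro member_le_sum) auto
        moreover have "(\<Sum>k=1..j. c j k) = offdiag c j + c j j"
          using j by (intro sum_upto_diag) simp
        ultimately have "min (int (c j m)) (negp z m) < int (c j m)"
          using fails 3 by simp
        then have "negp z m < int (c j m)"
          by simp
        then show ?thesis
          using key[of j] drop[OF lam_j] m negI by fastforce
      qed
    qed (use lam_j in simp)
  qed
  have off2: "offdiag c 2 = c 2 1"
    by (simp add: offdiag_def)
  then have "lam 2 < 0"
    using claim[of 2] j c12 by auto
  \<comment> \<open>Entry 1 of z^- is at least \<open>c 2 1\<close>, so subtracting
    \<open>uvec c 2\<close> from z^- is feasible and lowers the degree.\<close>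
  have "z 1 = (\<Sum>k=1+1..n. lam k * int (c k 1))"
    using uvec_combination_entry[of 1 lam] j by (simp add: z)
  also have "\<dots> \<le> lam 2 * int (c 2 1)"
    using j claim by (intro tail) auto
  also have "\<dots> \<le> - int (c 2 1)"
    using mult_right_mono[of "lam 2" "-1" "int (c 2 1)"] \<open>lam 2 < 0\<close> by simp
  finally have "up_reduces c 2 (\<lambda>i. - z i)"
    using c12 off2 posp_nonneg[of z 2]
    by (simp add: up_reduces_def posp_uminus negp_uminus) (simp add: negp_def)
  then show False
    using up'[of 2] j by simp
qed

lemma distance_reducing_if_cond_R:
  assumes "n \<ge> 2" and a12: "a 1 < a 2"
    and gen: "\<And>z. z \<in> kerA n a \<Longrightarrow> \<exists>lam. z = (\<lambda>i. \<Sum>k=2..n. lam k * uvec c k i)"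
    and R: "\<And>i j. 2 \<le> i \<Longrightarrow> i < j \<Longrightarrow> j \<le> n \<Longrightarrow> cond_R c i j"
  shows "distance_reducing n a (uvec c ` {2..n})"
  unfolding distance_reducing_def reduces_distance_def
proof (intro ballI impI)
  fix z assume "z \<in> kerA n a" and nz: "z \<noteq> (\<lambda>_. 0)"
  then obtain lam where z: "z = (\<lambda>i. \<Sum>k=2..n. lam k * uvec c k i)"
    using gen by blast
  have "c 2 2 < c 2 1"
  proof (rule ccontr)
    assume "\<not> ?thesis"
    moreover have "a 1 * int (c 2 1) = a 2 * int (c 2 2)"
      using relation[of 2] assms(1) by simp
    moreover have "a 1 * int (c 2 2) < a 2 * int (c 2 2)"
      using a12 diag_pos[of 2] assms(1) by simp
    moreover have "a 1 > 0"
      using a_pos[of 1] assms(1) by simp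
    ultimately show False
      using mult_left_mono[of "int (c 2 1)" "int (c 2 2)" "a 1"] by linarith
  qed
  note core = reduced_if_cond_R[OF _ this]
  define J where "J = {k\<in>{2..n}. lam k \<noteq> 0}"
  have "J \<noteq> {}"
  proof
    assume "J = {}"
    then have "\<forall>k\<in>{2..n}. lam k = 0"
      by (auto simp: J_def)
    then show False
      using nz z by simp
  qed
  moreover have "finite J"
    by (simp add: J_def)
  ultimately have "Max J \<in> J" and top: "\<And>k. k \<in> J \<Longrightarrow> k \<le> Max J"
    by auto
  then have j: "Max J \<in> {2..n}" "lam (Max J) \<noteq> 0"
    by (auto simp: J_def)
  have lam_0: "lam k = 0" if "k \<in> {Max J + 1..n}" for k
  proof -
    have "k \<notin> J" and "k \<in> {2..n}"
      using top[of k] that j(1) by auto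
    then show ?thesis
      unfolding J_def by blast
  qed
  have R': "cond_R c i (Max J)" if "2 \<le> i" "i < Max J" for i
    using R[of i "Max J"] that j(1) by simp
  have "\<exists>k\<in>{2..n}. reduces_distance_of_vec n (uvec c k) z"
  proof (cases "lam (Max J) < 0")
    case True
    show ?thesis
      by (rule core[OF j(1) R' True lam_0 z])
  next
    \<comment> \<open>A positive top coefficient becomes negative for -z, and reduction is invariant
      under this change.\<close>
    case False
    have "\<exists>k\<in>{2..n}. reduces_distance_of_vec n (uvec c k) (\<lambda>i. - z i)"
      by (rule core[OF j(1) R', of "\<lambda>k. - lam k"]) (use False j(2) lam_0 in \<open>auto simp: z sum_negf\<close>)
    then show ?thesis
      using reduces_uvec_uminus by fastforce
  qed
  then show "\<exists>u\<in>uvec c ` {2..n}. reduces_distance_of_vec n u z"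
    by blast
qed

end

section \<open>Reduction of the circuits implies the conditions\<close>

definition good_child :: "(nat \<Rightarrow> nat \<Rightarrow> nat) \<Rightarrow> nat \<Rightarrow> nat \<Rightarrow> bool" where
  "good_child c s l \<longleftrightarrow> s \<in> {1..l-1} \<and> (\<forall>m\<in>{1..l-1} - {s}. c l m = 0) \<and> c l l < c l s"

text \<open>Indices reached from r through successive good children. The bound \<open>j < l\<close>
  keeps every index other than the root beyond j, for both roots i and j.\<close>

inductive descendant :: "(nat \<Rightarrow> nat \<Rightarrow> nat) \<Rightarrow> nat \<Rightarrow> nat \<Rightarrow> nat \<Rightarrow> nat \<Rightarrow> bool"
  for c n j r where
    root: "descendant c n j r r"
  | child: "descendant c n j r s \<Longrightarrow> good_child c s l \<Longrightarrow> j < l \<Longrightarrow> l \<le> n \<Longrightarrow> descendant c n j r l"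

lemma good_child_parent_unique:
  "good_child c s l \<Longrightarrow> m \<in> {1..l-1} \<Longrightarrow> c l m > 0 \<Longrightarrow> m = s"
  unfolding good_child_def by (metis Diff_iff less_numeral_extra(3) singletonD)

lemma offdiag_good_child: "good_child c s l \<Longrightarrow> offdiag c l = c l s"
  unfolding good_child_def by (blast intro: offdiag_single)

lemma descendant_cases:
  assumes "descendant c n j r x"
  obtains "x = r" | s where "descendant c n j r s" "good_child c s x" "j < x" "x \<le> n"
  using assms by cases auto

text \<open>Parents are unique, so two descents to x would share the parent of x. Going back ends at
  i, which is below j and thus not a descendant of j.\<close>

lemma descendants_disjoint:
  assumes "descendant c n j i x" "i < j"
  shows "\<not> descendant c n j j x"
  using assms(1)
proof induction
  case root
  show ?case
    using assms(2) by (auto elim: descendant_cases)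
next
  case (child s l)
  show ?case
  proof
    assume "descendant c n j j l"
    then show False
    proof (cases rule: descendant_cases)
      case (2 s')
      then have "s' = s"
        using good_child_parent_unique[OF child(2), of s'] by (auto simp: good_child_def)
      then show False
        using child.IH 2 by blast
    qed (use child in simp)
  qed
qed

context triangular_kernel_vectors
begin

text \<open>A down move must consume s, so k = s and only cancellation at t helps. An up move can
  consume only s, so \<open>uvec c k\<close> has support {s, k}: either k = t, or nothing cancels at
  k and the degree must drop, which makes k a good child.\<close>

lemma reduced_pair_cases:
  assumes k: "k \<in> {2..n}" and st: "s \<in> {1..n}" "t \<in> {1..n}" "s \<noteq> t"
    and z: "z s > 0" "z t < 0" "\<And>i. i \<noteq> s \<Longrightarrow> i \<noteq> t \<Longrightarrow> z i = 0"
    and red: "down_reduces c k z \<or> up_reduces c k z"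
  shows "offdiag c s < c s s + (if t < s then 2 * c s t else 0)
    \<or> (\<exists>l\<le>n. good_child c s l)
    \<or> (s < t \<and> (\<forall>m\<in>{1..t-1} - {s}. c t m = 0))"
  using red
proof
  assume d: "down_reduces c k z"
  then have "posp z k > 0"
    using diag_pos[OF k] by (simp add: down_reduces_def)
  then have "k = s"
    using z by (metis less_irrefl max.absorb2 order.asym order.strict_implies_order posp_def order_refl)
  have neg0: "negp z m = 0" if "m \<noteq> t" for m
    using z that by (cases "m = s") (auto simp: negp_def)
  have "(\<Sum>m=1..s-1. min (int (c s m)) (negp z m)) \<le> (\<Sum>m=1..s-1. if m = t then int (c s t) else 0)"
    using neg0 by (intro sum_mono) auto
  also have "\<dots> \<le> (if t < s then int (c s t) else 0)"
    using st by auto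
  finally have "int (offdiag c s) < int (c s s) + 2 * (if t < s then int (c s t) else 0)"
    using d unfolding down_reduces_def \<open>k = s\<close> by (cases "t < s") auto
  then have "offdiag c s < c s s + (if t < s then 2 * c s t else 0)"
    by (simp split: if_splits)
  then show ?thesis
    by blast
next
  assume u: "up_reduces c k z"
  have pos0: "posp z m = 0" if "m \<noteq> s" for m
    using z that by (cases "m = t") (auto simp: posp_def)
  have 0: "\<forall>m\<in>{1..k-1} - {s}. c k m = 0"
  proof
    fix m assume m: "m \<in> {1..k-1} - {s}"
    then have "int (c k m) \<le> posp z m"
      using u unfolding up_reduces_def by blast
    then show "c k m = 0"
      using pos0[of m] m by simp
  qed
  obtain m where "m \<in> {1..k-1}" "c k m > 0"
    using offdiag_nonzero[OF k] .
  then have s: "s \<in> {1..k-1}"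
    using 0 by (metis Diff_iff less_numeral_extra(3) singletonD)
  show ?thesis
  proof (cases "k = t")
    case True
    then show ?thesis
      using 0 s by auto
  next
    case False
    then have "negp z k = 0"
      using z s by (auto simp: negp_def)
    then have "c k k < c k s"
      using u offdiag_single[of s k c, OF s 0] by (simp add: up_reduces_def)
    then show ?thesis
      using 0 s k unfolding good_child_def by auto
  qed
qed

lemma circuit_reduced_cases:
  assumes red: "reduces_distance n a (uvec c ` {2..n}) (circuits n a)"
    and st: "s \<in> {1..n}" "t \<in> {1..n}" "s \<noteq> t"
  shows "offdiag c s < c s s + (if t < s then 2 * c s t else 0)
    \<or> (\<exists>l\<le>n. good_child c s l)
    \<or> (s < t \<and> (\<forall>m\<in>{1..t-1} - {s}. c t m = 0))
    \<or> offdiag c t < c t t + (if s < t then 2 * c t s else 0)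
    \<or> (\<exists>l\<le>n. good_child c t l)
    \<or> (t < s \<and> (\<forall>m\<in>{1..s-1} - {t}. c s m = 0))"
proof -
  \<comment> \<open>The circuit on {s, t}; the pair analysis applies to it and, with s and t
    exchanged, to its negative.\<close>
  define z where "z = (\<lambda>i. if i = s then a t else if i = t then - a s else 0)"
  have z: "z s > 0" "z t < 0" "\<And>i. i \<noteq> s \<Longrightarrow> i \<noteq> t \<Longrightarrow> z i = 0"
    using st a_pos by (auto simp: z_def)
  have "(\<Sum>i=1..n. a i * z i) = (\<Sum>i\<in>{s,t}. a i * z i)"
    using st by (intro sum.mono_neutral_right) (auto simp: z_def)
  also have "\<dots> = 0"
    using st by (simp add: z_def)
  finally have "z \<in> kerA n a"
    using st by (auto simp: kerA_def z_def)
  moreover have "{i\<in>{1..n}. z i \<noteq> 0} = {s, t}"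
    using st z by force
  ultimately have "z \<in> circuits n a" and "z \<noteq> (\<lambda>_. 0)"
    using st z(1) by (auto simp: circuits_def)
  then obtain k where k: "k \<in> {2..n}" and "reduces_distance_of_vec n (uvec c k) z"
    using red unfolding reduces_distance_def by blast
  then consider "down_reduces c k z \<or> up_reduces c k z"
    | "down_reduces c k (\<lambda>i. - z i) \<or> up_reduces c k (\<lambda>i. - z i)"
    by (auto simp: reduces_uvec_iff)
  then show ?thesis
  proof cases
    case 1
    then show ?thesis
      using reduced_pair_cases[OF k st z] by blast
  next
    case 2
    have "offdiag c t < c t t + (if s < t then 2 * c t s else 0)
      \<or> (\<exists>l\<le>n. good_child c t l)
      \<or> (t < s \<and> (\<forall>m\<in>{1..s-1} - {t}. c s m = 0))"
      by (rule reduced_pair_cases[OF k st(2,1) st(3)[symmetric] _ _ _ 2]) (use z in auto)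
    then show ?thesis
      by blast
  qed
qed

text \<open>Pairs of a descendant s of i and a descendant t of j are examined by induction on 2n -
  (s + t). A reduced circuit on {s, t} can only lead to a further descendant, which the induction
  excludes.\<close>

lemma cond_R_if_circuits_reduced:
  assumes red: "reduces_distance n a (uvec c ` {2..n}) (circuits n a)"
    and ij: "2 \<le> i" "i < j" "j \<le> n"
  shows "cond_R c i j"
proof (rule ccontr)
  assume notR: "\<not> cond_R c i j"
  have "(\<Sum>k=1..j. c j k) = offdiag c j + c j j"
    using ij by (intro sum_upto_diag) simp
  then have R1: "\<not> offdiag c i < c i i"
    and R3: "\<not> offdiag c j < c j j + 2 * c j i"
    using notR by (auto simp: cond_R_def offdiag_def)
  have R2: "\<not> good_child c i l" if "l < j" for l
  proof
    assume "good_child c i l"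
    then have "l \<in> {i+1..j-1}" "(\<forall>m\<in>{1..l-1} - {i}. c l m = 0) \<and> c l i > c l l"
      using that by (auto simp: good_child_def)
    then show False
      using notR unfolding cond_R_def by blast
  qed
  \<comment> \<open>If i were the only index below j in the support, the negation of (iii) would
    give c_ji \<ge> c_jj + 2 c_ji, against c_jj > 0.\<close>
  have R3': "\<exists>m\<in>{1..j-1} - {i}. c j m \<noteq> 0"
  proof (rule ccontr)
    assume "\<not> ?thesis"
    then have "offdiag c j = c j i"
      using ij by (intro offdiag_single) auto
    then show False
      using R3 diag_pos[of j] ij by simp
  qed
  have rng: "x \<in> {1..n} \<and> (x = r \<or> j < x)" if "descendant c n j r x" "r \<in> {1..n}" for r x
    using that by (auto elim: descendant_cases)
  have False if "descendant c n j i s" "descendant c n j j t" for s t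
    using that
  proof (induction "2 * n - (s + t)" arbitrary: s t rule: less_induct)
    case less
    note s = less.prems(1) and t = less.prems(2)
    have sr: "s \<in> {1..n}" "s = i \<or> j < s" and tr: "t \<in> {1..n}" "t = j \<or> j < t"
      using rng[OF s] rng[OF t] ij by auto
    have st: "s \<noteq> t"
      using descendants_disjoint[OF s ij(2)] t by auto
    have parent_s: "m \<noteq> t" if "descendant c n j i m" for m
      using descendants_disjoint[OF that ij(2)] t by blast
    have parent_t: "m \<noteq> s" if "descendant c n j j m" for m
      using descendants_disjoint[OF s ij(2)] that by blast
    have no_s: "\<not> descendant c n j i l" if "s < l" for l
    proof
      assume l: "descendant c n j i l"
      have "2 * n - (l + t) < 2 * n - (s + t)"
        using that rng[OF l] ij tr(1) by auto
      from less.hyps[OF this l t] show False .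
    qed
    have no_t: "\<not> descendant c n j j l" if "t < l" for l
    proof
      assume l: "descendant c n j j l"
      have "2 * n - (s + l) < 2 * n - (s + t)"
        using that rng[OF l] ij sr(1) by auto
      from less.hyps[OF this s l] show False .
    qed
    from circuit_reduced_cases[OF red sr(1) tr(1) st]
    consider (A) "offdiag c s < c s s + (if t < s then 2 * c s t else 0)"
      | (B) l where "l \<le> n" "good_child c s l"
      | (C) "s < t" "\<forall>m\<in>{1..t-1} - {s}. c t m = 0"
      | (A') "offdiag c t < c t t + (if s < t then 2 * c t s else 0)"
      | (B') l where "l \<le> n" "good_child c t l"
      | (C') "t < s" "\<forall>m\<in>{1..s-1} - {t}. c s m = 0"
      by blast
    then show False
    proof cases
      \<comment> \<open>For s = i this is alternative (i). Otherwise the parent entry of s already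
        exceeds the diagonal, so cancellation at t is required and t is the parent of s; but parents
        of s descend from i.\<close>
      case A
      show False
        using s
      proof (cases rule: descendant_cases)
        case 1
        then show False
          using A R1 tr ij by auto
      next
        case (2 m)
        then have "offdiag c s > c s s"
          using offdiag_good_child[OF 2(2)] by (simp add: good_child_def)
        then have "t < s" "c s t > 0"
          using A by (auto split: if_splits)
        then have "t = m"
          using good_child_parent_unique[OF 2(2), of t] tr by auto
        then show False
          using parent_s 2 by blast
      qed
    next
      case B
      then have "s < l"
        by (auto simp: good_child_def)
      \<comment> \<open>A good child of i below j is alternative (ii), and j itself is excluded by
        \<open>R3'\<close>.\<close>
      have "j < l"
      proof (cases "s = i")
        case True
        have "l \<noteq> j"
          using B R3' True by (auto simp: good_child_def)
        then show ?thesis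
          using B R2 True by (meson linorder_neqE_nat)
      qed (use sr \<open>s < l\<close> in auto)
      then show False
        using no_s[OF \<open>s < l\<close>] descendant.child[OF s B(2) _ B(1)] by blast
    next
      \<comment> \<open>For t = j the index s must be i, against \<open>R3'\<close>. Otherwise s
        would be the parent of t and so a descendant of j.\<close>
      case C
      show False
        using t
      proof (cases rule: descendant_cases)
        case 1
        then have "s = i"
          using C sr by auto
        then show False
          using C 1 R3' by auto
      next
        case (2 m)
        then have "m \<in> {1..t-1}" "c t m \<noteq> 0"
          by (auto simp: good_child_def)
        then have "m = s"
          using C(2) by (metis DiffI singletonD)
        then show False
          using parent_t 2 by blast
      qed
    next
      \<comment> \<open>For t = j this contradicts the negation of (iii), cancellation being
        possible only at s = i. Otherwise s would be the parent of t.\<close>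
      case A'
      show False
        using t
      proof (cases rule: descendant_cases)
        case 1
        then show False
          using A' R3 sr by (auto split: if_splits)
      next
        case (2 m)
        then have "offdiag c t > c t t"
          using offdiag_good_child[OF 2(2)] by (simp add: good_child_def)
        then have "s < t" "c t s > 0"
          using A' by (auto split: if_splits)
        then have "s = m"
          using good_child_parent_unique[OF 2(2), of s] sr by auto
        then show False
          using parent_t 2 by blast
      qed
    next
      case B'
      then have "t < l"
        by (auto simp: good_child_def)
      then show False
        using no_t[OF \<open>t < l\<close>] descendant.child[OF t B'(2) _ B'(1)] tr by auto
    next
      case C'
      show False
        using s
      proof (cases rule: descendant_cases)
        case 1
        then show False
          using C' tr ij by auto
      next
        case (2 m)
        then have "m \<in> {1..s-1}" "c s m \<noteq> 0"
          by (auto simp: good_child_def)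
        then have "m = t"
          using C'(2) by (metis DiffI singletonD)
        then show False
          using parent_s 2 by blast
      qed
    qed
  qed
  then show False
    using descendant.root by blast
qed

end

theorem theorem4p3:
  fixes n :: nat and a :: "nat \<Rightarrow> int" and c :: "nat \<Rightarrow> nat \<Rightarrow> nat"
  assumes "n \<ge> 2"
    and "\<forall>i\<in>{1..n}. a i > 0"
    and "a 1 < a 2"
    and "gluing_first_kind n a"
    and "\<forall>k\<in>{2..n}. c k k > 0"
    and "minimal_markov_basis TYPE('k::field) n a (uvec c ` {2..n})"
  shows "(distance_reducing n a (uvec c ` {2..n})
           \<longleftrightarrow> reduces_distance n a (uvec c ` {2..n}) (circuits n a))
       \<and> (reduces_distance n a (uvec c ` {2..n}) (circuits n a)
           \<longleftrightarrow> (\<forall>i j. 2 \<le> i \<and> i < j \<and> j \<le> n \<longrightarrow> cond_R c i j))"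
proof -
  have markov: "markov_basis TYPE('k) n a (uvec c ` {2..n})"
    using assms(6) by (simp add: minimal_markov_basis_def)
  interpret triangular_kernel_vectors n a c
    using assms(2,5) markov by unfold_locales (auto simp: markov_basis_def)
  \<comment> \<open>The integer span of the vectors, the lattice to which
    \<open>markov_basis_generates_lattice\<close> is applied.\<close>
  define L where "L = {x. \<exists>lam. x = (\<lambda>i. \<Sum>k=2..n. lam k * uvec c k i)}"
  have "z \<in> L" if "z \<in> kerA n a" for z
  proof (rule markov_basis_generates_lattice[OF markov _ _ _ _ that])
    show "uvec c ` {2..n} \<subseteq> L"
    proof
      fix u assume "u \<in> uvec c ` {2..n}"
      then obtain k where "k \<in> {2..n}" "u = uvec c k"
        by blast
      then have "u = (\<lambda>i. \<Sum>l=2..n. (if l = k then 1 else 0) * uvec c l i)"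
        by (simp add: fun_eq_iff if_distrib[of "\<lambda>x. x * _"] cong: if_cong)
      then show "u \<in> L"
        unfolding L_def by (intro CollectI exI)
    qed
    have "(\<lambda>_. 0) = (\<lambda>i. \<Sum>k=2..n. 0 * uvec c k i)"
      by simp
    then show "(\<lambda>_. 0) \<in> L"
      unfolding L_def by (intro CollectI exI)
    show "(\<lambda>i. x i + y i) \<in> L" if xy: "x \<in> L" "y \<in> L" for x y
    proof -
      obtain lam mu where "x = (\<lambda>i. \<Sum>k=2..n. lam k * uvec c k i)" "y = (\<lambda>i. \<Sum>k=2..n. mu k * uvec c k i)"
        using xy unfolding L_def by blast
      then have "(\<lambda>i. x i + y i) = (\<lambda>i. \<Sum>k=2..n. (lam k + mu k) * uvec c k i)"
        by (simp add: sum.distrib distrib_right)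
      then show ?thesis
        unfolding L_def by (intro CollectI exI)
    qed
    show "(\<lambda>i. - x i) \<in> L" if x: "x \<in> L" for x
    proof -
      obtain lam where "x = (\<lambda>i. \<Sum>k=2..n. lam k * uvec c k i)"
        using x unfolding L_def by blast
      then have "(\<lambda>i. - x i) = (\<lambda>i. \<Sum>k=2..n. (- lam k) * uvec c k i)"
        by (simp add: sum_negf)
      then show ?thesis
        unfolding L_def by (intro CollectI exI)
    qed
  qed
  then have gen: "\<exists>lam. z = (\<lambda>i. \<Sum>k=2..n. lam k * uvec c k i)" if "z \<in> kerA n a" for z
    using that unfolding L_def by blast
  have "reduces_distance n a (uvec c ` {2..n}) (circuits n a)"
    if "distance_reducing n a (uvec c ` {2..n})"
    using that by (simp add: distance_reducing_def reduces_distance_def circuits_def)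
  moreover have "\<forall>i j. 2 \<le> i \<and> i < j \<and> j \<le> n \<longrightarrow> cond_R c i j"
    if "reduces_distance n a (uvec c ` {2..n}) (circuits n a)"
    using cond_R_if_circuits_reduced[OF that] by blast
  moreover have "distance_reducing n a (uvec c ` {2..n})"
    if "\<forall>i j. 2 \<le> i \<and> i < j \<and> j \<le> n \<longrightarrow> cond_R c i j"
    using distance_reducing_if_cond_R[OF assms(1,3) gen] that by blast
  ultimately show ?thesis
    by blast
qed

end
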